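(* Let $n\ge 1$ and let $\alpha_1 \geq \cdots \geq \alpha_n \geq 0$ be real numbers. Then each edge (one-dimensional face) of the polytope $\Gamma(\alpha_1,\dots,\alpha_n)\subset\mathbb{R}^{n+1}$ is parallel to the difference $e_i-e_j$ of two standard basis vectors of $\mathbb{R}^{n+1}$.
   Context: Write $[m]=\{1,\dots,m\}$, $\bar\alpha=\alpha_1+\dots+\alpha_n$, and for $I\subseteq[n+1]$ let $I^c=[n+1]\setminus I$. For $I\subseteq[n+1]$ put $z_I=\sum_{i=1}^{\#I-1}\alpha_{n+1-i}$ if $n+1\in I$, and $z_I=0$ otherwise (in particular $z_\emptyset=0$ and $z_{[n+1]}=\bar\alpha$). The homogeneous SIM-body is $$\Gamma(\alpha_1,\dots,\alpha_n)=\Bigl\{x\in\mathbb{R}^{n+1}\ \Big|\ \sum_{i=1}^{n+1}x_i=z_{[n+1]},\ \sum_{i\in I}x_i\le z_{[n+1]}-z_{I^c}\text{ for all }\emptyset\ne I\subseteq[n+1]\Bigr\}.$$ *)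

theory Defs
  imports "HOL-Analysis.Analysis"
begin

definition z_SIM :: "nat \<Rightarrow> (nat \<Rightarrow> real) \<Rightarrow> nat set \<Rightarrow> real" where
  "z_SIM n \<alpha> I = (if n + 1 \<in> I then (\<Sum>i=1..card I - 1. \<alpha> (n + 1 - i)) else 0)"

text \<open>
  The ambient space is \<^typ>\<open>real ^ 'k\<close>; the map \<open>idx\<close> is meant to be a bijection
  from \<open>{1..n + 1}\<close> onto the index type, so that \<open>x $ idx i\<close> is the \<open>i\<close>-th
  coordinate of \<open>x\<close>. Only the values \<open>\<alpha> 1, \<dots>, \<alpha> n\<close> of \<open>\<alpha>\<close> matter.
\<close>

definition SIM_body :: "(nat \<Rightarrow> 'k::finite) \<Rightarrow> nat \<Rightarrow> (nat \<Rightarrow> real) \<Rightarrow> (real ^ 'k) set" where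
  "SIM_body idx n \<alpha> =
    {x. (\<Sum>i\<in>{1..n + 1}. x $ idx i) = z_SIM n \<alpha> {1..n + 1} \<and>
        (\<forall>I. I \<noteq> {} \<and> I \<subseteq> {1..n + 1} \<longrightarrow>
          (\<Sum>i\<in>I. x $ idx i) \<le> z_SIM n \<alpha> {1..n + 1} - z_SIM n \<alpha> ({1..n + 1} - I))}"

end

theory Submission
  imports Defs
begin

text \<open>
  The function \<open>z\<close> is supermodular: among the sets containing \<open>n + 1\<close> it is a convex function
  of the cardinality, because it sums the smallest \<open>\<alpha> i\<close> first, and otherwise it is \<open>0\<close>, which
  is no larger because the \<open>\<alpha> i\<close> are nonnegative. Passing to complements turns
  \<open>I \<mapsto> z\<^bsub>[n+1]\<^esub> - z\<^bsub>I\<^sup>c\<^esub>\<close> into a submodular function \<open>h\<close>, so that the SIM-body is the base polytope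
  of \<open>h\<close>. The theorem therefore is an instance of the fact that the edges of every base
  polytope are parallel to differences of unit vectors (\<open>base_polytope_edge_parallel\<close>).

  For the latter, let \<open>x\<close> be the midpoint of two distinct points \<open>a\<close>, \<open>b\<close> of an edge \<open>F\<close>. The
  inequalities that are tight at \<open>x\<close> are tight at \<open>a\<close> and \<open>b\<close>, hence \<open>d = b - a\<close> has sum \<open>0\<close>
  over each tight set. By submodularity the tight sets are closed under intersection. If they
  separated any two indices, then peeling off the least tight set around each index would
  force \<open>d = 0\<close> (\<open>separating_family_determines_function\<close>). So some \<open>i \<noteq> j\<close> lie in
  exactly the same tight sets; then moving \<open>x\<close> a little in both directions along \<open>e\<^sub>i - e\<^sub>j\<close>
  violates no inequality, and since \<open>F\<close> is a face, this segment lies in \<open>F\<close>. As \<open>F\<close> is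
  one-dimensional, \<open>e\<^sub>i - e\<^sub>j\<close> is its direction.
\<close>

section \<open>Base polytopes of submodular functions\<close>

definition submodular :: "('k set \<Rightarrow> real) \<Rightarrow> bool" where
  "submodular h \<longleftrightarrow> (\<forall>I J. h (I \<union> J) + h (I \<inter> J) \<le> h I + h J)"

definition base_polytope :: "('k::finite set \<Rightarrow> real) \<Rightarrow> (real ^ 'k) set" where
  "base_polytope h = {x. (\<Sum>k\<in>UNIV. x $ k) = h UNIV \<and> (\<forall>I. (\<Sum>k\<in>I. x $ k) \<le> h I)}"

text \<open>
  At the union and the intersection of two tight sets, the two sides of the submodular
  inequality squeeze the sums of \<open>x\<close>, so neither constraint has slack left.
\<close>

lemma tight_Int:
  assumes "submodular h" and "x \<in> base_polytope h"
    and "(\<Sum>k\<in>I. x $ k) = h I" and "(\<Sum>k\<in>J. x $ k) = h J"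
  shows "(\<Sum>k\<in>I \<inter> J. x $ k) = h (I \<inter> J)"
proof -
  have "(\<Sum>k\<in>I \<union> J. x $ k) + (\<Sum>k\<in>I \<inter> J. x $ k) = h I + h J"
    using sum.union_inter[of I J "\<lambda>k. x $ k"] assms(3,4) by simp
  moreover have "h (I \<union> J) + h (I \<inter> J) \<le> h I + h J"
    using assms(1) by (simp add: submodular_def)
  moreover have "(\<Sum>k\<in>I \<union> J. x $ k) \<le> h (I \<union> J)" "(\<Sum>k\<in>I \<inter> J. x $ k) \<le> h (I \<inter> J)"
    using assms(2) by (auto simp: base_polytope_def)
  ultimately show ?thesis by linarith
qed

text \<open>
  Let \<open>D i\<close> be the least member of the family that contains \<open>i\<close>. For \<open>j \<in> D i\<close> with \<open>j \<noteq> i\<close>,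
  separation makes \<open>D j\<close> a proper subset of \<open>D i\<close>, so by induction on the size of \<open>D i\<close> the
  sum of \<open>d\<close> over \<open>D i\<close> reduces to \<open>d i\<close>.
\<close>

lemma separating_family_determines_function:
  fixes d :: "'k::finite \<Rightarrow> real"
  assumes univ: "UNIV \<in> T" and int: "\<And>I J. I \<in> T \<Longrightarrow> J \<in> T \<Longrightarrow> I \<inter> J \<in> T"
    and sep: "\<And>i j. i \<noteq> j \<Longrightarrow> \<exists>I\<in>T. (i \<in> I) \<noteq> (j \<in> I)"
    and zero: "\<And>I. I \<in> T \<Longrightarrow> sum d I = 0"
  shows "d i = 0"
proof -
  define D where "D i = \<Inter>{I \<in> T. i \<in> I}" for i
  have D_in: "D i \<in> T" for i
  proof -
    have "\<Inter>S \<in> T" if "finite S" "S \<subseteq> T" for S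
      using that by (induction S rule: finite_induct) (auto simp: univ int)
    then show ?thesis unfolding D_def by auto
  qed
  have i_in: "i \<in> D i" for i by (auto simp: D_def)
  have D_le: "D j \<subseteq> I" if "I \<in> T" "j \<in> I" for I j
    using that by (auto simp: D_def)
  show ?thesis
  proof (induction "card (D i)" arbitrary: i rule: less_induct)
    case less
    have "d j = 0" if j: "j \<in> D i" "j \<noteq> i" for j
    proof (rule less)
      obtain I where I: "I \<in> T" "(i \<in> I) \<noteq> (j \<in> I)" using sep[of i j] j by auto
      have "D j \<noteq> D i" using D_le[OF I(1), of i] D_le[OF I(1), of j] I(2) i_in by auto
      then have "D j \<subset> D i" using D_le[OF D_in j(1)] by auto
      then show "card (D j) < card (D i)" by (simp add: psubset_card_mono)
    qed
    then have "sum d (D i - {i}) = 0" by (auto intro: sum.neutral)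
    then show "d i = 0"
      using zero[OF D_in[of i]] sum.remove[of "D i" i d] i_in by simp
  qed
qed

text \<open>
  The finitely many constraints that are not tight at \<open>x\<close> leave room for a small step in
  any direction, and the tight ones do not change along \<open>v\<close>.
\<close>

lemma base_polytope_small_step:
  assumes x: "x \<in> base_polytope h"
    and v: "\<And>I. (\<Sum>k\<in>I. x $ k) = h I \<Longrightarrow> (\<Sum>k\<in>I. v $ k) = 0"
  shows "\<exists>\<epsilon>>0. x + \<epsilon> *\<^sub>R v \<in> base_polytope h \<and> x - \<epsilon> *\<^sub>R v \<in> base_polytope h"
proof -
  let ?s = "\<lambda>I. h I - (\<Sum>k\<in>I. x $ k)" and ?w = "\<lambda>I. \<Sum>k\<in>I. v $ k"
  have ev: "eventually (\<lambda>\<epsilon>. \<epsilon> * \<bar>?w I\<bar> \<le> ?s I) (at_right 0)" for I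
  proof (cases "?s I = 0")
    case True
    then show ?thesis using v[of I] by simp
  next
    case False
    then have pos: "0 < ?s I" using x by (auto simp: base_polytope_def less_le)
    have "((\<lambda>\<epsilon>. \<epsilon> * \<bar>?w I\<bar>) \<longlongrightarrow> 0 * \<bar>?w I\<bar>) (at_right 0)" by (intro tendsto_intros)
    then have "eventually (\<lambda>\<epsilon>. \<epsilon> * \<bar>?w I\<bar> < ?s I) (at_right 0)"
      using pos by (intro order_tendstoD) auto
    then show ?thesis by (rule eventually_mono) simp
  qed
  have "eventually (\<lambda>\<epsilon>. 0 < \<epsilon> \<and> (\<forall>I. \<epsilon> * \<bar>?w I\<bar> \<le> ?s I)) (at_right 0)"
    using ev eventually_at_right_less[of "0::real"]
    by (auto intro!: eventually_conj eventually_all_finite)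
  then obtain \<epsilon> where \<epsilon>: "0 < \<epsilon>" "\<And>I. \<epsilon> * \<bar>?w I\<bar> \<le> ?s I"
    using eventually_happens'[OF trivial_limit_at_right_real] by blast
  have "\<bar>\<epsilon> * ?w I\<bar> \<le> ?s I" for I using \<epsilon> by (simp add: abs_mult)
  moreover have "?w UNIV = 0" using x by (intro v) (simp add: base_polytope_def)
  ultimately have "x + \<epsilon> *\<^sub>R v \<in> base_polytope h \<and> x - \<epsilon> *\<^sub>R v \<in> base_polytope h"
    using x unfolding base_polytope_def
    by (simp add: sum.distrib sum_subtractf flip: sum_distrib_left) (smt (verit))
  then show ?thesis using \<epsilon>(1) by blast
qed

theorem base_polytope_edge_parallel:
  fixes h :: "'k::finite set \<Rightarrow> real"
  assumes sub: "submodular h" and F: "F edge_of base_polytope h"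
  shows "\<exists>i j. i \<noteq> j \<and> affine_parallel (affine hull F) (span {axis i 1 - axis j 1})"
proof -
  have face: "F face_of base_polytope h" and dimF: "aff_dim F = 1"
    using F by (auto simp: edge_of_def)
  have "F \<noteq> {}" using dimF by auto
  then obtain a where a: "a \<in> F" by auto
  have "F \<noteq> {a}" using dimF by auto
  then obtain b where b: "b \<in> F" "b \<noteq> a" using a by auto
  define x where "x = midpoint a b"
  have "convex F" using face by (rule face_of_imp_convex)
  then have "closed_segment a b \<subseteq> F" using a b(1) by (rule closed_segment_subset[rotated 2])
  then have xF: "x \<in> F" unfolding x_def using midpoint_in_closed_segment[of a b] by (rule subsetD)
  have sub_B: "F \<subseteq> base_polytope h" using face by (rule face_of_imp_subset)
  define T where "T = {I. (\<Sum>k\<in>I. x $ k) = h I}"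
  have d0: "(\<Sum>k\<in>I. (b - a) $ k) = 0" if "I \<in> T" for I
  proof -
    have "(\<Sum>k\<in>I. a $ k) \<le> h I" "(\<Sum>k\<in>I. b $ k) \<le> h I"
      using a b(1) sub_B by (auto simp: base_polytope_def)
    moreover have "((\<Sum>k\<in>I. a $ k) + (\<Sum>k\<in>I. b $ k)) / 2 = h I"
      using that by (simp add: T_def x_def midpoint_def sum.distrib flip: sum_divide_distrib)
    ultimately show ?thesis by (simp add: sum_subtractf)
  qed
  have "\<exists>i j. i \<noteq> j \<and> (\<forall>I\<in>T. (i \<in> I) = (j \<in> I))"
  proof (rule ccontr)
    assume "\<not> ?thesis"
    then have sep: "\<And>i j. i \<noteq> j \<Longrightarrow> \<exists>I\<in>T. (i \<in> I) \<noteq> (j \<in> I)" by blast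
    have "(b - a) $ k = 0" for k
    proof (rule separating_family_determines_function[of T "\<lambda>k. (b - a) $ k", OF _ _ sep d0])
      show "UNIV \<in> T" using xF sub_B by (auto simp: T_def base_polytope_def)
      show "I \<inter> J \<in> T" if "I \<in> T" "J \<in> T" for I J
        using tight_Int[OF sub, of x I J] that xF sub_B by (auto simp: T_def)
    qed
    then show False using b(2) by (simp add: vec_eq_iff)
  qed
  then obtain i j where ij: "i \<noteq> j" "\<And>I. I \<in> T \<Longrightarrow> (i \<in> I) = (j \<in> I)" by blast
  define v :: "real ^ 'k" where "v = axis i 1 - axis j 1"
  have "(\<Sum>k\<in>I. v $ k) = 0" if "(\<Sum>k\<in>I. x $ k) = h I" for I
    using ij(2)[of I] that by (simp add: T_def v_def axis_def sum_subtractf)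
  then obtain \<epsilon> where \<epsilon>: "\<epsilon> > 0" "x + \<epsilon> *\<^sub>R v \<in> base_polytope h" "x - \<epsilon> *\<^sub>R v \<in> base_polytope h"
    using base_polytope_small_step[of x h v] xF sub_B by blast
  have v0: "v \<noteq> 0" using ij(1) by (auto simp: v_def axis_eq_axis)
  have "x = midpoint (x - \<epsilon> *\<^sub>R v) (x + \<epsilon> *\<^sub>R v)"
    by (simp add: midpoint_def flip: scaleR_add_left)
  moreover have "x - \<epsilon> *\<^sub>R v \<noteq> x + \<epsilon> *\<^sub>R v" using \<epsilon>(1) v0
    by (simp add: algebra_simps flip: scaleR_add_left)
  ultimately have "x \<in> open_segment (x - \<epsilon> *\<^sub>R v) (x + \<epsilon> *\<^sub>R v)"
    using midpoint_in_open_segment by metis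
  then have step: "x + \<epsilon> *\<^sub>R v \<in> F" using face_ofD[OF face] \<epsilon> xF sub_B by blast
  obtain L where L: "subspace L" "affine_parallel (affine hull F) L"
    using affine_parallel_subspace[of "affine hull F"] \<open>F \<noteq> {}\<close> by auto
  have "affine hull L = L" using L(1) by (simp add: subspace_imp_affine affine_hull_eq)
  then have "aff_dim L = 1" using aff_dim_parallel_eq[of F L] L(2) dimF by metis
  then have dimL: "dim L = 1" using aff_dim_subspace[OF L(1)] by simp
  obtain c where c: "L = (+) c ` (affine hull F)" using L(2) by (auto simp: affine_parallel_def)
  have "c + x \<in> L" "c + (x + \<epsilon> *\<^sub>R v) \<in> L" using c xF step by (auto intro: hull_inc)
  then have "\<epsilon> *\<^sub>R v \<in> L" using subspace_diff[OF L(1)] by force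
  then have "v \<in> L" using subspace_scale[OF L(1), of _ "1 / \<epsilon>"] \<epsilon>(1) by force
  then have "span {v} = L"
    using L(1) dimL v0 by (intro subspace_dim_equal) (auto simp: span_minimal dim_singleton)
  then show ?thesis using L(2) ij(1) unfolding v_def by blast
qed

section \<open>The SIM-body as a base polytope\<close>

text \<open>
  Replacing the block \<open>s + 1, \<dots>, p\<close> of indices by the block \<open>q + 1, \<dots>, r\<close> of the same length
  moves every index up, so a nondecreasing \<open>f\<close> has the larger sum there.
\<close>

lemma partial_sums_convex:
  fixes f :: "nat \<Rightarrow> real"
  assumes mono: "\<And>i j. 1 \<le> i \<Longrightarrow> i \<le> j \<Longrightarrow> j \<le> n \<Longrightarrow> f i \<le> f j"
    and "s \<le> p" "s \<le> q" "p + q = r + s" "r \<le> n"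
  shows "(\<Sum>i=1..p. f i) + (\<Sum>i=1..q. f i) \<le> (\<Sum>i=1..r. f i) + (\<Sum>i=1..s. f i)"
proof -
  have "p = s + m \<Longrightarrow> r = q + m \<Longrightarrow> ?thesis" for m
    using \<open>r \<le> n\<close>
  proof (induction m arbitrary: p r)
    case (Suc m)
    have "f (Suc (s + m)) \<le> f (Suc (q + m))"
      using Suc.prems \<open>s \<le> q\<close> by (intro mono) auto
    then show ?case using Suc.IH[of "s + m" "q + m"] Suc.prems by simp
  qed simp
  moreover have "p = s + (p - s)" "r = q + (p - s)" using assms(2-4) by auto
  ultimately show ?thesis by blast
qed

lemma z_SIM_supermodular:
  assumes mono: "\<And>i j. 1 \<le> i \<Longrightarrow> i \<le> j \<Longrightarrow> j \<le> n \<Longrightarrow> \<alpha> j \<le> \<alpha> i"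
    and nonneg: "\<And>i. 1 \<le> i \<Longrightarrow> i \<le> n \<Longrightarrow> 0 \<le> \<alpha> i"
    and I: "I \<subseteq> {1..n + 1}" and J: "J \<subseteq> {1..n + 1}"
  shows "z_SIM n \<alpha> I + z_SIM n \<alpha> J \<le> z_SIM n \<alpha> (I \<union> J) + z_SIM n \<alpha> (I \<inter> J)"
proof -
  have fin: "finite I" "finite J" using I J finite_subset by blast+
  have cU: "card (I \<union> J) \<le> n + 1"
    using card_mono[of "{1..n + 1}" "I \<union> J"] I J by auto
  have le: "(\<Sum>i=1..card K - 1. \<alpha> (n + 1 - i)) \<le> (\<Sum>i=1..card (I \<union> J) - 1. \<alpha> (n + 1 - i))"
    if "K \<subseteq> I \<union> J" for K
    using that fin cU card_mono[of "I \<union> J" K] by (intro sum_mono2) (auto intro!: nonneg)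
  consider "n + 1 \<in> I" "n + 1 \<in> J" | "n + 1 \<in> I" "n + 1 \<notin> J" | "n + 1 \<notin> I" "n + 1 \<in> J"
    | "n + 1 \<notin> I" "n + 1 \<notin> J" by blast
  then show ?thesis
  proof cases
    case 1
    have "0 < card (I \<inter> J)" using 1 fin by (auto simp: card_gt_0_iff)
    moreover have "card (I \<inter> J) \<le> card I" "card (I \<inter> J) \<le> card J"
      using fin by (auto intro: card_mono)
    moreover have "card I + card J = card (I \<union> J) + card (I \<inter> J)"
      using fin by (rule card_Un_Int)
    ultimately have "(\<Sum>i=1..card I - 1. \<alpha> (n + 1 - i)) + (\<Sum>i=1..card J - 1. \<alpha> (n + 1 - i))
      \<le> (\<Sum>i=1..card (I \<union> J) - 1. \<alpha> (n + 1 - i)) + (\<Sum>i=1..card (I \<inter> J) - 1. \<alpha> (n + 1 - i))"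
      using cU by (intro partial_sums_convex[where n = n]) (auto intro!: mono)
    then show ?thesis using 1 by (simp add: z_SIM_def)
  qed (use le[of I] le[of J] in \<open>auto simp: z_SIM_def\<close>)
qed

theorem theorem9:
  fixes n :: nat and \<alpha> :: "nat \<Rightarrow> real"
    and idx :: "nat \<Rightarrow> 'k::finite" and F :: "(real ^ 'k) set"
  assumes "n \<ge> 1"
    and "bij_betw idx {1..n + 1} (UNIV :: 'k set)"
    and "\<And>i j. 1 \<le> i \<Longrightarrow> i \<le> j \<Longrightarrow> j \<le> n \<Longrightarrow> \<alpha> j \<le> \<alpha> i"
    and "\<And>i. 1 \<le> i \<Longrightarrow> i \<le> n \<Longrightarrow> 0 \<le> \<alpha> i"
    and "F edge_of SIM_body idx n \<alpha>"
  shows "\<exists>i\<in>{1..n + 1}. \<exists>j\<in>{1..n + 1}. i \<noteq> j \<and>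
    affine_parallel (affine hull F) (span {axis (idx i) 1 - axis (idx j) 1})"
proof -
  let ?N = "{1..n + 1}"
  have inj: "inj_on idx ?N" and surj: "idx ` ?N = UNIV"
    using assms(2) by (auto simp: bij_betw_def)
  \<comment> \<open>the complement in \<open>{1..n + 1}\<close> of the index set that \<open>idx\<close> maps onto \<open>K\<close>\<close>
  define C where "C K = {i \<in> ?N. idx i \<notin> K}" for K
  have C_subset: "C K \<subseteq> ?N" for K by (auto simp: C_def)
  define h where "h K = z_SIM n \<alpha> ?N - z_SIM n \<alpha> (C K)" for K
  have "submodular h"
  proof -
    have "z_SIM n \<alpha> (C I) + z_SIM n \<alpha> (C J) \<le> z_SIM n \<alpha> (C (I \<union> J)) + z_SIM n \<alpha> (C (I \<inter> J))"
      for I J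
    proof -
      have "C I \<union> C J = C (I \<inter> J)" "C I \<inter> C J = C (I \<union> J)" by (auto simp: C_def)
      then show ?thesis
        using z_SIM_supermodular[where \<alpha> = \<alpha>, OF _ _ C_subset[of I] C_subset[of J]] assms(3,4)
        by (simp add: add.commute)
    qed
    then show ?thesis by (simp add: submodular_def h_def algebra_simps)
  qed
  moreover have "SIM_body idx n \<alpha> = base_polytope h"
  proof -
    have reindex: "(\<Sum>k\<in>idx ` I. x $ k) = (\<Sum>i\<in>I. x $ idx i)" if "I \<subseteq> ?N" for I and x :: "real ^ 'k"
      using sum.reindex[OF inj_on_subset[OF inj that], of "\<lambda>k. x $ k"] by simp
    have C_image: "C (idx ` I) = ?N - I" if "I \<subseteq> ?N" for I
      using inj_on_image_mem_iff[OF inj _ that] unfolding C_def by blast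
    have "C UNIV = {}" "C {} = ?N" by (auto simp: C_def)
    then have hN: "h UNIV = z_SIM n \<alpha> ?N" and h0: "h {} = 0"
      by (simp_all add: h_def z_SIM_def)
    have "(\<forall>K. (\<Sum>k\<in>K. x $ k) \<le> h K) \<longleftrightarrow>
      (\<forall>I. I \<noteq> {} \<and> I \<subseteq> ?N \<longrightarrow>
        (\<Sum>i\<in>I. x $ idx i) \<le> z_SIM n \<alpha> ?N - z_SIM n \<alpha> (?N - I))" (is "?L \<longleftrightarrow> ?R") for x
    proof
      assume L: ?L
      show ?R
      proof (intro allI impI)
        fix I assume I: "I \<noteq> {} \<and> I \<subseteq> ?N"
        then show "(\<Sum>i\<in>I. x $ idx i) \<le> z_SIM n \<alpha> ?N - z_SIM n \<alpha> (?N - I)"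
          using L[rule_format, of "idx ` I"] reindex[of I x] C_image[of I] by (simp add: h_def)
      qed
    next
      assume R: ?R
      show ?L
      proof
        fix K
        obtain I where I: "I \<subseteq> ?N" "K = idx ` I" using surj by (metis subset_UNIV subset_imageE)
        show "(\<Sum>k\<in>K. x $ k) \<le> h K"
        proof (cases "I = {}")
          case True
          then show ?thesis using I h0 by simp
        next
          case False
          then show ?thesis
            using R[rule_format, of I] I reindex[of I x] C_image[of I] by (simp add: h_def)
        qed
      qed
    qed
    moreover have "(\<Sum>k\<in>UNIV. x $ k) = (\<Sum>i\<in>?N. x $ idx i)" for x :: "real ^ 'k"
      using reindex[of ?N x] surj by simp
    ultimately show ?thesis by (simp only: SIM_body_def base_polytope_def hN)
  qed
  ultimately obtain k l where kl: "k \<noteq> l"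
    "affine_parallel (affine hull F) (span {axis k 1 - axis l 1})"
    using base_polytope_edge_parallel[of h F] assms(5) by auto
  obtain i j where ij: "i \<in> ?N" "k = idx i" "j \<in> ?N" "l = idx j"
    using surj by (metis UNIV_I imageE)
  have "i \<noteq> j" using kl(1) ij by auto
  moreover have "affine_parallel (affine hull F) (span {axis (idx i) 1 - axis (idx j) 1})"
    using kl(2) ij by simp
  ultimately show ?thesis
    by (intro bexI[of _ i] bexI[of _ j] conjI) (rule ij(1) ij(3) | assumption)+
qed

end
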